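(* Let $T$ be any spanning tree of $\tilde G$. An $x\in\mathbb X_{nc}$ satisfies $$\exists\,\theta\in\mathbb R^n:\quad B\theta=\beta(x)\mod 2\pi \qquad ( * )$$ if and only if around each undirected cycle $c$ of $\tilde G$ we have $\sum_{(j,k)\in c}\tilde\beta_{jk}(x)=0\mod 2\pi$. In that case $\theta(x)=\mathcal P\left(B_T^{-1}\beta_T(x)\right)$ is the unique solution $\theta$ of $B\theta=\beta(x)\mod 2\pi$ in $(-\pi,\pi]^n$.
   Context: Let $N^+=\{0,\dots,n\}$, $N=\{1,\dots,n\}$ and let $\tilde G=(N^+,\tilde E)$ be a connected directed graph with $m=|\tilde E|$ edges, obtained by arbitrarily orienting a connected undirected simple graph. Each line $j\to k\in\tilde E$ has nonzero complex impedance $z_{jk}$. For complex numbers, $a\le b$ means inequality of both real and imaginary parts. Given are bounds $\underline v_j\le\overline v_j$ with $\underline v_j>0$ and complex bounds $\underline s_j,\overline s_j$ (possibly infinite), $j\in N^+$; for the slack bus $\underline v_0=\overline v_0=1$ and the bounds on $s_0$ are infinite (no constraint). $\mathbb X_{nc}$ is the set of $x=(S,\ell,v,s)\in\mathbb R^{3(m+n+1)}$ ($S\in\mathbb C^m$ and $s\in\mathbb C^{n+1}$ regarded as real vectors, $\ell\in\mathbb R^m$, $v\in\mathbb R^{n+1}$) such that - $\sum_{k:j\to k}S_{jk}=\sum_{i:i\to j}(S_{ij}-z_{ij}\ell_{ij})+s_j$, $j\in N^+$; - $v_j-v_k=2\operatorname{Re}(z_{jk}^HS_{jk})-|z_{jk}|^2\ell_{jk}$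 and $v_j\ell_{jk}=|S_{jk}|^2$, $j\to k\in\tilde E$; - $\underline v_j\le v_j\le\overline v_j$ and $\underline s_j\le s_j\le\overline s_j$, $j\in N^+$. For $x=(S,\ell,v,s)$ define $\beta(x)\in\mathbb R^m$ by $\beta_{jk}(x)=\angle(v_j-z_{jk}^HS_{jk})$ for $j\to k\in\tilde E$, and its extension to undirected links by $\tilde\beta_{jk}(x)=\beta_{jk}(x)$, $\tilde\beta_{kj}(x)=-\beta_{jk}(x)$ for $j\to k\in\tilde E$. An undirected cycle is $c=(j_1,\dots,j_K)$ such that for each $i$ either $j_i\to j_{i+1}\in\tilde E$ or $j_{i+1}\to j_i\in\tilde E$, with $j_{K+1}:=j_1$; the sum over $(j,k)\in c$ is over the pairs $(j_i,j_{i+1})$, $i=1,\dots,K$. $B$ is the $m\times n$ reduced incidence matrix: for $l\in\tilde E$, $j\in N$, $B_{lj}=1$ if $l$ leaves $j$, $-1$ if $l$ enters $j$, $0$ otherwise. For a spanning tree $T$ (on all nodes $N^+$, with $n$ links), $B_T$ is the $n\times n$ submatrix of $B$ of the rows of links in $T$ and $\beta_T(x)$ is the corresponding subvector of $\beta(x)$. $\mathcal P(\phi)$ projects $\phi\in\mathbb R^n$ to $(-\pi,\pi]^n$ by reducing each component modulo $2\pi$. Equalities mod $2\pi$ are componentwise. *)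

theory Defs
  imports
    "HOL-Library.Extended_Real"
    "HOL-Library.Real_Mod"
    "Graph_Theory.Digraph_Component"
    "Jordan_Normal_Form.Gauss_Jordan_Elimination"
    "Jordan_Normal_Form.DL_Submatrix"
begin

(* Buses are the numbers 0, ..., n, lines the numbers 0, ..., m - 1; line e leads from tail G e
   to head G e. Numbering the lines fixes the order of the rows of B and of the entries of all
   vectors indexed by lines. The locale digraph only excludes loops and parallel arcs, so
   antiparallel ones have to be excluded separately. Digraph_Component.connected is weak
   connectedness. *)
definition network_graph :: "nat \<Rightarrow> nat \<Rightarrow> (nat, nat) pre_digraph \<Rightarrow> bool" where
  "network_graph n m G \<longleftrightarrow>
     digraph G \<and> verts G = {0..n} \<and> arcs G = {0..<m} \<and>
     (\<forall>j k. j \<rightarrow>\<^bsub>G\<^esub> k \<longrightarrow> \<not> k \<rightarrow>\<^bsub>G\<^esub> j) \<and>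
     Digraph_Component.connected G"

definition next_node :: "nat list \<Rightarrow> nat \<Rightarrow> nat" where
  "next_node c i = c ! (Suc i mod length c)"

(* No repetition of nodes is excluded: c is any closed walk in the underlying undirected graph. *)
definition undirected_cycle :: "(nat, nat) pre_digraph \<Rightarrow> nat list \<Rightarrow> bool" where
  "undirected_cycle G c \<longleftrightarrow> c \<noteq> [] \<and>
     (\<forall>i<length c. c ! i \<rightarrow>\<^bsub>G\<^esub> next_node c i \<or> next_node c i \<rightarrow>\<^bsub>G\<^esub> c ! i)"

(* Digraph_Component.spanning_tree is not used: it only excludes directed cycles, and so does not
   describe the trees of the underlying undirected graph.
   A spanning tree is given by its set T of lines; that there are n of them is redundant. *)
definition spanning_tree_lines :: "(nat, nat) pre_digraph \<Rightarrow> nat set \<Rightarrow> bool" where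
  "spanning_tree_lines G T \<longleftrightarrow>
     T \<subseteq> arcs G \<and> Suc (card T) = card (verts G) \<and>
     Digraph_Component.connected (G\<lparr>arcs := T\<rparr>) \<and>
     \<not> (\<exists>c. undirected_cycle (G\<lparr>arcs := T\<rparr>) c \<and> distinct c \<and> 3 \<le> length c)"

(* x = (S, l, v, s) *)
type_synonym bfm_point = "complex vec \<times> real vec \<times> real vec \<times> complex vec"

(* The pair (a, b) bounds the real part by a and the imaginary part by b. *)
type_synonym cbound = "ereal \<times> ereal"

definition within_cbounds :: "cbound \<Rightarrow> complex \<Rightarrow> cbound \<Rightarrow> bool" where
  "within_cbounds lo w up \<longleftrightarrow>
     fst lo \<le> ereal (Re w) \<and> ereal (Re w) \<le> fst up \<and>
     snd lo \<le> ereal (Im w) \<and> ereal (Im w) \<le> snd up"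

definition X_nc ::
  "nat \<Rightarrow> nat \<Rightarrow> (nat, nat) pre_digraph \<Rightarrow> (nat \<Rightarrow> complex) \<Rightarrow>
   (nat \<Rightarrow> real) \<Rightarrow> (nat \<Rightarrow> real) \<Rightarrow> (nat \<Rightarrow> cbound) \<Rightarrow> (nat \<Rightarrow> cbound) \<Rightarrow> bfm_point set" where
  "X_nc n m G z v_lo v_up s_lo s_up =
     {(S, l, v, s).
        S \<in> carrier_vec m \<and> l \<in> carrier_vec m \<and>
        v \<in> carrier_vec (n + 1) \<and> s \<in> carrier_vec (n + 1) \<and>
        (\<forall>j\<in>verts G.
           (\<Sum>e\<in>out_arcs G j. S $ e) =
           (\<Sum>e\<in>in_arcs G j. S $ e - z e * complex_of_real (l $ e)) + s $ j) \<and>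
        (\<forall>e\<in>arcs G.
           v $ tail G e - v $ head G e = 2 * Re (cnj (z e) * S $ e) - (cmod (z e))\<^sup>2 * l $ e \<and>
           v $ tail G e * l $ e = (cmod (S $ e))\<^sup>2) \<and>
        (\<forall>j\<in>verts G. v_lo j \<le> v $ j \<and> v $ j \<le> v_up j \<and> within_cbounds (s_lo j) (s $ j) (s_up j))}"

definition beta ::
  "nat \<Rightarrow> (nat, nat) pre_digraph \<Rightarrow> (nat \<Rightarrow> complex) \<Rightarrow> bfm_point \<Rightarrow> real vec" where
  "beta m G z x = (case x of (S, l, v, s) \<Rightarrow>
     vec m (\<lambda>e. Arg (complex_of_real (v $ tail G e) - cnj (z e) * S $ e)))"

definition line :: "(nat, nat) pre_digraph \<Rightarrow> nat \<Rightarrow> nat \<Rightarrow> nat" where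
  "line G j k = (THE e. e \<in> arcs G \<and> tail G e = j \<and> head G e = k)"

(* Only meaningful if j and k are joined by a line, in one direction or the other. *)
definition beta_ext :: "(nat, nat) pre_digraph \<Rightarrow> real vec \<Rightarrow> nat \<Rightarrow> nat \<Rightarrow> real" where
  "beta_ext G b j k = (if j \<rightarrow>\<^bsub>G\<^esub> k then b $ line G j k else - (b $ line G k j))"

(* Column j - 1 belongs to bus j; the slack bus 0 has no column. *)
definition inc_mat :: "nat \<Rightarrow> nat \<Rightarrow> (nat, nat) pre_digraph \<Rightarrow> real mat" where
  "inc_mat n m G = mat m n (\<lambda>(e, j).
     if tail G e = Suc j then 1 else if head G e = Suc j then - 1 else 0)"

definition tree_mat :: "nat \<Rightarrow> nat \<Rightarrow> (nat, nat) pre_digraph \<Rightarrow> nat set \<Rightarrow> real mat" where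
  "tree_mat n m G T = submatrix (inc_mat n m G) T UNIV"

(* pick T i is the i-th smallest element of T, the order in which submatrix keeps the rows. *)
definition tree_vec :: "real vec \<Rightarrow> nat set \<Rightarrow> real vec" where
  "tree_vec b T = vec (card T) (\<lambda>i. b $ pick T i)"

definition cong_2pi :: "real vec \<Rightarrow> real vec \<Rightarrow> bool" where
  "cong_2pi u w \<longleftrightarrow> dim_vec u = dim_vec w \<and> (\<forall>i<dim_vec w. [u $ i = w $ i] (rmod (2 * pi)))"

definition principal_box :: "nat \<Rightarrow> real vec set" where
  "principal_box n = {\<theta> \<in> carrier_vec n. \<forall>i<n. - pi < \<theta> $ i \<and> \<theta> $ i \<le> pi}"

(* t rmod (2 * pi) lies in [0, 2 pi); the reflection moves the half-open end to the right. *)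
definition principal :: "real vec \<Rightarrow> real vec" where
  "principal \<phi> = map_vec (\<lambda>t. pi - (pi - t) rmod (2 * pi)) \<phi>"

lemma principal_in_box: "\<phi> \<in> carrier_vec n \<Longrightarrow> principal \<phi> \<in> principal_box n"
  using rmod_less[of "2 * pi"] rmod_nonneg[of "2 * pi"]
  by (auto simp: principal_def principal_box_def algebra_simps)

lemma principal_cong: "cong_2pi (principal \<phi>) \<phi>"
proof -
  have "[pi - (pi - t) rmod (2 * pi) = t] (rmod (2 * pi))" for t :: real
    unfolding rcong_altdef
    by (rule exI[of _ "- \<lfloor>(pi - t) / (2 * pi)\<rfloor>"]) (simp add: rmod_def algebra_simps)
  then show ?thesis by (simp add: cong_2pi_def principal_def)
qed

end

theory Submission
  imports Defs "Jordan_Normal_Form.Determinant"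
begin

text \<open>
  A solution of \<open>B \<theta> = \<beta>\<close> modulo \<open>2\<pi>\<close> is a node potential, grounded at the slack bus, whose
  differences along the lines are the \<open>\<beta>\<close>-values. Such differences telescope around a cycle;
  conversely, if all cycle sums vanish, the sum of \<open>\<beta>\<close> along a walk from a node to the slack bus
  does not depend on the walk and is a potential. Two grounded potentials whose differences agree
  modulo \<open>p\<close> along the lines of a connected subgraph agree modulo \<open>p\<close> everywhere. For \<open>p = 0\<close> this
  makes \<open>B\<^sub>T\<close> injective, hence invertible; for \<open>p = 2\<pi>\<close> it shows that every solution is congruent
  to \<open>B\<^sub>T\<^sup>-\<^sup>1 \<beta>\<^sub>T\<close>, so the integrality of \<open>B\<^sub>T\<^sup>-\<^sup>1\<close> is never needed.
\<close>

section \<open>Sums along walks\<close>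

fun walk_sum :: "('a \<Rightarrow> 'a \<Rightarrow> 'b::comm_monoid_add) \<Rightarrow> 'a list \<Rightarrow> 'b" where
  "walk_sum f (x # y # zs) = f x y + walk_sum f (y # zs)"
| "walk_sum f _ = 0"

lemma walk_sum_conv_nth: "walk_sum f xs = (\<Sum>i<length xs - 1. f (xs ! i) (xs ! Suc i))"
  by (induction f xs rule: walk_sum.induct) (simp_all add: sum.lessThan_Suc_shift del: sum.lessThan_Suc)

text \<open>The link between the two pieces is counted by repeating the first node of
  \<open>ys\<close> after \<open>xs\<close>.\<close>

lemma walk_sum_append:
  "ys \<noteq> [] \<Longrightarrow> walk_sum f (xs @ ys) = walk_sum f (xs @ [hd ys]) + walk_sum f ys"
proof (induction xs)
  case Nil
  then show ?case by simp
next
  case (Cons x xs)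
  then show ?case
    by (cases xs; cases ys) (simp_all add: add.assoc)
qed

lemma walk_sum_diff:
  fixes \<phi> :: "'a \<Rightarrow> 'b::ab_group_add"
  shows "xs \<noteq> [] \<Longrightarrow> walk_sum (\<lambda>j k. \<phi> j - \<phi> k) xs = \<phi> (hd xs) - \<phi> (last xs)"
  by (induction xs rule: induct_list012) simp_all

lemma walk_sum_rcong:
  assumes "successively R xs" and "\<And>j k. R j k \<Longrightarrow> [f j k = g j k] (rmod p)"
  shows "[walk_sum f xs = walk_sum g xs] (rmod p)"
  using assms(1) by (induction xs rule: induct_list012) (auto intro!: rcong_add assms(2))

section \<open>Potentials from closed walks\<close>

text \<open>The end node is split off so that a walk \<open>u @ [j]\<close> and a walk
  \<open>xs @ [r]\<close> starting in \<open>j\<close> concatenate to \<open>u @ xs @ [r]\<close>,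
  with their common node \<open>j\<close> written once.\<close>

lemma rtranclp_imp_walk:
  assumes "R\<^sup>*\<^sup>* j k"
  shows "\<exists>xs. successively R (xs @ [k]) \<and> hd (xs @ [k]) = j"
  using assms
proof (induction rule: converse_rtranclp_induct)
  case base
  show ?case by (rule exI[of _ "[]"]) simp
next
  case (step i j)
  then obtain xs where "successively R (xs @ [k])" "hd (xs @ [k]) = j" by blast
  with \<open>R i j\<close> show ?case
    by (intro exI[of _ "i # xs"]) (cases xs; simp)
qed

text \<open>The potential of \<open>j\<close> is, up to a constant, the sum along a chosen walk from
  \<open>j\<close> to \<open>r\<close>. Two walks from \<open>j\<close> to \<open>r\<close> have
  congruent sums because one and the same walk from \<open>r\<close> to \<open>j\<close> closes
  both. No walk is reversed, so \<open>f j k\<close> and \<open>f k j\<close> may be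
  unrelated.\<close>

lemma closed_walks_imp_potential:
  fixes f :: "'a \<Rightarrow> 'a \<Rightarrow> real"
  assumes conn: "\<And>j k. j \<in> V \<Longrightarrow> k \<in> V \<Longrightarrow> R\<^sup>*\<^sup>* j k" and "r \<in> V"
    and closed: "\<And>c. c \<noteq> [] \<Longrightarrow> successively R (c @ [hd c]) \<Longrightarrow>
      [walk_sum f (c @ [hd c]) = 0] (rmod p)"
  shows "\<exists>\<phi>. \<phi> r = 0 \<and> (\<forall>j\<in>V. \<forall>k\<in>V. R j k \<longrightarrow> [f j k = \<phi> j - \<phi> k] (rmod p))"
proof -
  have "\<forall>j\<in>V. \<exists>xs. successively R (xs @ [r]) \<and> hd (xs @ [r]) = j"
    using conn \<open>r \<in> V\<close> rtranclp_imp_walk by metis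
  then obtain w where w: "successively R (w j @ [r])" "hd (w j @ [r]) = j" if "j \<in> V" for j
    by metis
  \<comment> \<open>The walk chosen from \<open>r\<close> to itself may be nontrivial; subtracting
    its sum makes \<open>\<phi> r = 0\<close>.\<close>
  define \<phi> where "\<phi> j = walk_sum f (w j @ [r]) - walk_sum f (w r @ [r])" for j
  have "[f j k = \<phi> j - \<phi> k] (rmod p)" if jk: "j \<in> V" "k \<in> V" "R j k" for j k
  proof -
    obtain u where u: "successively R (u @ [j])" "hd (u @ [j]) = r"
      using rtranclp_imp_walk[OF conn[OF \<open>r \<in> V\<close> \<open>j \<in> V\<close>]] by blast
    have return: "[walk_sum f (u @ [j]) + walk_sum f (xs @ [r]) = 0] (rmod p)"
      if "successively R (xs @ [r])" "hd (xs @ [r]) = j" for xs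
    \<comment> \<open>If both lists are empty, then \<open>j = r\<close> and both sums are 0;
      \<open>closed\<close> speaks only of nonempty \<open>c\<close>.\<close>
    proof (cases "u @ xs = []")
      case True
      then show ?thesis by simp
    next
      case False
      have hd: "hd (u @ xs) = r"
        using u(2) that(2) False by (cases u; cases xs; simp)
      have "successively R ((u @ xs) @ [r])"
        using u(1) that by (auto simp: successively_append_iff)
      with closed[OF False] hd have "[walk_sum f (u @ xs @ [r]) = 0] (rmod p)" by simp
      then show ?thesis
        using walk_sum_append[of "xs @ [r]" f u] that(2) by simp
    qed
    \<comment> \<open>Two ways back from \<open>j\<close> to \<open>r\<close> are compared: the walk
      chosen for \<open>j\<close>, and the step to \<open>k\<close> followed by the walk chosen for
      \<open>k\<close>.\<close>
    have "[walk_sum f (u @ [j]) + walk_sum f (w j @ [r]) = 0] (rmod p)"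
      using return w[OF \<open>j \<in> V\<close>] by blast
    moreover have "[walk_sum f (u @ [j]) + walk_sum f ((j # w k) @ [r]) = 0] (rmod p)"
      using w[OF \<open>k \<in> V\<close>] \<open>R j k\<close> by (intro return) (cases "w k"; simp)+
    ultimately have "[walk_sum f (u @ [j]) + walk_sum f ((j # w k) @ [r]) =
        walk_sum f (u @ [j]) + walk_sum f (w j @ [r])] (rmod p)"
      using rcong_trans[OF _ rcong_sym] by blast
    then have "[walk_sum f ((j # w k) @ [r]) = walk_sum f (w j @ [r])] (rmod p)"
      by simp
    moreover have "walk_sum f ((j # w k) @ [r]) = f j k + walk_sum f (w k @ [r])"
      using w(2)[OF \<open>k \<in> V\<close>] by (cases "w k") simp_all
    ultimately show ?thesis
      using rcong_diff[of "f j k + walk_sum f (w k @ [r])" "walk_sum f (w j @ [r])" p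
          "walk_sum f (w k @ [r])" "walk_sum f (w k @ [r])"]
      by (simp add: \<phi>_def)
  qed
  then show ?thesis
    by (intro exI[of _ \<phi>]) (simp add: \<phi>_def)
qed

section \<open>Weak connectedness and undirected cycles\<close>

definition adjacent :: "('a, 'b) pre_digraph \<Rightarrow> 'a \<Rightarrow> 'a \<Rightarrow> bool" where
  "adjacent G j k \<longleftrightarrow> j \<rightarrow>\<^bsub>G\<^esub> k \<or> k \<rightarrow>\<^bsub>G\<^esub> j"

text \<open>Weak connectedness is strong connectedness of the symmetric closure, whose arcs are
  exactly the \<open>adjacent\<close> pairs.\<close>

lemma connected_imp_rtranclp_adjacent:
  assumes "Digraph_Component.connected G" "j \<in> verts G" "k \<in> verts G"
  shows "(adjacent G)\<^sup>*\<^sup>* j k"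
proof -
  have "(j, k) \<in> (parcs (mk_symmetric G))\<^sup>*"
    using assms reachable_rtranclI[of "with_proj (mk_symmetric G)" j k]
    by (auto simp: Digraph_Component.connected_def strongly_connected_def)
  moreover have "parcs (mk_symmetric G) = {(j, k). adjacent G j k}"
    by (auto simp: parcs_mk_symmetric adjacent_def arcs_ends_conv)
  ultimately show ?thesis
    by (simp add: rtranclp_rtrancl_eq)
qed

text \<open>Starting from the agreement at \<open>r\<close>, induction goes backwards along a path
  from \<open>j\<close> to \<open>r\<close>. Each link adds its congruence of differences, negated
  if the link is traversed against its orientation.\<close>

lemma connected_imp_rcong:
  fixes \<phi> \<psi> :: "'a \<Rightarrow> real"
  assumes "Digraph_Component.connected G" "j \<in> verts G" "r \<in> verts G"
    and "\<And>e. e \<in> arcs G \<Longrightarrow>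
      [\<phi> (tail G e) - \<phi> (head G e) = \<psi> (tail G e) - \<psi> (head G e)] (rmod p)"
    and "\<phi> r = \<psi> r"
  shows "[\<phi> j = \<psi> j] (rmod p)"
  using connected_imp_rtranclp_adjacent[OF assms(1-3)]
proof (induction rule: converse_rtranclp_induct)
  case base
  show ?case by (simp add: assms(5))
next
  case (step i k)
  from \<open>adjacent G i k\<close> obtain e where e: "e \<in> arcs G"
    and "i = tail G e \<and> k = head G e \<or> k = tail G e \<and> i = head G e"
    by (auto simp: adjacent_def arcs_ends_conv)
  then have "[\<phi> i - \<phi> k = \<psi> i - \<psi> k] (rmod p)"
  proof (elim disjE conjE)
    assume "i = tail G e" "k = head G e"
    then show ?thesis using assms(4)[OF e] by simp
  next
    assume "k = tail G e" "i = head G e"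
    then show ?thesis using rcong_uminus[OF assms(4)[OF e]] by simp
  qed
  from rcong_add[OF this step.IH] show ?case by simp
qed

text \<open>Appending the first node replaces the cyclic index \<open>Suc i mod length c\<close> by
  an ordinary successor, so a cycle becomes a walk in list form.\<close>

lemma closed_walk_nth:
  assumes "c \<noteq> []" "i < length c"
  shows "(c @ [hd c]) ! i = c ! i" "(c @ [hd c]) ! Suc i = next_node c i"
  using assms by (auto simp: nth_append next_node_def hd_conv_nth not_less_eq less_Suc_eq)

lemma undirected_cycle_iff:
  "undirected_cycle G c \<longleftrightarrow> c \<noteq> [] \<and> successively (adjacent G) (c @ [hd c])"
  by (auto simp: undirected_cycle_def successively_conv_nth adjacent_def closed_walk_nth)

lemma sum_next_node:
  "c \<noteq> [] \<Longrightarrow> (\<Sum>i<length c. f (c ! i) (next_node c i)) = walk_sum f (c @ [hd c])"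
  by (simp add: walk_sum_conv_nth closed_walk_nth)

section \<open>Bus angles and the incidence matrix\<close>

text \<open>The slack bus has no entry in \<theta>; its angle is the reference 0. With it, the lines
  at the slack bus also give plain differences of angles.\<close>

definition bus_angle :: "real vec \<Rightarrow> nat \<Rightarrow> real" where
  "bus_angle \<theta> j = (case j of 0 \<Rightarrow> 0 | Suc i \<Rightarrow> \<theta> $ i)"

lemma network_graph_arcs:
  assumes "network_graph n m G"
  shows "arcs G = {0..<m}"
    and "e < m \<Longrightarrow> tail G e \<le> n" and "e < m \<Longrightarrow> head G e \<le> n"
    and "e < m \<Longrightarrow> tail G e \<noteq> head G e"
proof -
  interpret digraph G using assms by (simp add: network_graph_def)
  show "arcs G = {0..<m}" "e < m \<Longrightarrow> tail G e \<le> n" "e < m \<Longrightarrow> head G e \<le> n"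
    "e < m \<Longrightarrow> tail G e \<noteq> head G e"
    using assms tail_in_verts head_in_verts no_loops by (auto simp: network_graph_def)
qed

lemma index_inc_mat_mult:
  assumes "network_graph n m G" "\<theta> \<in> carrier_vec n" "e < m"
  shows "(inc_mat n m G *\<^sub>v \<theta>) $ e = bus_angle \<theta> (tail G e) - bus_angle \<theta> (head G e)"
proof -
  \<comment> \<open>For the slack bus \<open>k = 0\<close> no column matches and the sum is 0, the
    reference angle; \<open>k \<le> n\<close> ensures that every other bus has a column.\<close>
  have ind: "(\<Sum>j<n. (if k = Suc j then \<theta> $ j else 0)) = bus_angle \<theta> k" if "k \<le> n" for k
    using that by (cases k) (simp_all add: bus_angle_def)
  have "(inc_mat n m G *\<^sub>v \<theta>) $ e = (\<Sum>j<n. (if tail G e = Suc j then 1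
      else if head G e = Suc j then - 1 else 0) * \<theta> $ j)"
    using assms by (simp add: inc_mat_def scalar_prod_def lessThan_atLeast0)
  \<comment> \<open>As there are no loops, the two tests never succeed together, so the nested
    conditional splits into a difference.\<close>
  also have "\<dots> = (\<Sum>j<n. (if tail G e = Suc j then \<theta> $ j else 0)
      - (if head G e = Suc j then \<theta> $ j else 0))"
    using network_graph_arcs(4)[OF assms(1,3)] by (intro sum.cong) auto
  also have "\<dots> = bus_angle \<theta> (tail G e) - bus_angle \<theta> (head G e)"
    using network_graph_arcs(2,3)[OF assms(1,3)] by (simp only: sum_subtractf ind)
  finally show ?thesis .
qed

lemma dim_inc_mat [simp]: "dim_row (inc_mat n m G) = m" "dim_col (inc_mat n m G) = n"
  by (simp_all add: inc_mat_def)

lemma cong_2pi_inc_mat_iff: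
  assumes "network_graph n m G" "\<theta> \<in> carrier_vec n" "dim_vec b = m"
  shows "cong_2pi (inc_mat n m G *\<^sub>v \<theta>) b \<longleftrightarrow>
    (\<forall>e<m. [bus_angle \<theta> (tail G e) - bus_angle \<theta> (head G e) = b $ e] (rmod (2 * pi)))"
  using assms by (simp add: cong_2pi_def index_inc_mat_mult del: index_mult_mat_vec)

section \<open>Link values and the cycle condition\<close>

lemma line_eq:
  assumes "network_graph n m G" "e \<in> arcs G"
  shows "line G (tail G e) (head G e) = e"
proof -
  interpret digraph G using assms by (simp add: network_graph_def)
  show ?thesis
    unfolding line_def using assms(2) no_multi_arcs by (auto simp: arc_to_ends_def)
qed

text \<open>A link traversed backwards changes sign on both sides. Adjacency ensures that one of the
  two orientations is a line, so that \<open>beta_ext\<close> is meaningful.\<close>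

lemma beta_ext_rcong:
  assumes G: "network_graph n m G"
    and \<phi>: "\<And>e. e < m \<Longrightarrow> [\<phi> (tail G e) - \<phi> (head G e) = b $ e] (rmod p)"
    and "adjacent G j k"
  shows "[beta_ext G b j k = \<phi> j - \<phi> k] (rmod p)"
proof (cases "j \<rightarrow>\<^bsub>G\<^esub> k")
  case True
  then obtain e where e: "e \<in> arcs G" "j = tail G e" "k = head G e"
    by (auto simp: arcs_ends_conv)
  with True \<phi>[of e] show ?thesis
    by (simp add: beta_ext_def line_eq[OF G] network_graph_arcs(1)[OF G] rcong_sym)
next
  case False
  with \<open>adjacent G j k\<close> obtain e where e: "e \<in> arcs G" "k = tail G e" "j = head G e"
    by (auto simp: adjacent_def arcs_ends_conv)
  with False \<phi>[of e] show ?thesis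
    using rcong_uminus[of "b $ e" "\<phi> k - \<phi> j" p]
    by (simp add: beta_ext_def line_eq[OF G] network_graph_arcs(1)[OF G] rcong_sym)
qed

lemma solvable_iff_cycle_condition:
  assumes G: "network_graph n m G" and b: "dim_vec b = m"
  shows "(\<exists>\<theta>\<in>carrier_vec n. cong_2pi (inc_mat n m G *\<^sub>v \<theta>) b) \<longleftrightarrow>
    (\<forall>c. undirected_cycle G c \<longrightarrow>
       [(\<Sum>i<length c. beta_ext G b (c ! i) (next_node c i)) = 0] (rmod (2 * pi)))"
    (is "?solvable \<longleftrightarrow> ?cycles")
proof
  assume ?solvable
  then obtain \<theta> where \<theta>: "\<theta> \<in> carrier_vec n" "cong_2pi (inc_mat n m G *\<^sub>v \<theta>) b" by blast
  show ?cycles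
  proof (intro allI impI)
    fix c assume "undirected_cycle G c"
    then have c: "c \<noteq> []" "successively (adjacent G) (c @ [hd c])"
      by (simp_all add: undirected_cycle_iff)
    \<comment> \<open>With every link value replaced by an angle difference the sum telescopes; the
      first and last nodes of \<open>c @ [hd c]\<close> coincide, so it vanishes.\<close>
    have "[walk_sum (beta_ext G b) (c @ [hd c]) =
        walk_sum (\<lambda>j k. bus_angle \<theta> j - bus_angle \<theta> k) (c @ [hd c])] (rmod (2 * pi))"
      using c(2) \<theta> cong_2pi_inc_mat_iff[OF G _ b]
      by (intro walk_sum_rcong[where R = "adjacent G"] beta_ext_rcong[OF G]) auto
    then show "[(\<Sum>i<length c. beta_ext G b (c ! i) (next_node c i)) = 0] (rmod (2 * pi))"
      using c(1) by (simp add: sum_next_node walk_sum_diff)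
  qed
next
  assume cycles: ?cycles
  have V: "verts G = {0..n}" and conn: "Digraph_Component.connected G"
    using G by (auto simp: network_graph_def)
  have "\<exists>\<phi>. \<phi> 0 = 0 \<and> (\<forall>j\<in>verts G. \<forall>k\<in>verts G. adjacent G j k \<longrightarrow>
      [beta_ext G b j k = \<phi> j - \<phi> k] (rmod (2 * pi)))"
  proof (rule closed_walks_imp_potential)
    show "(adjacent G)\<^sup>*\<^sup>* j k" if "j \<in> verts G" "k \<in> verts G" for j k
      using connected_imp_rtranclp_adjacent conn that .
    show "0 \<in> verts G" by (simp add: V)
    show "[walk_sum (beta_ext G b) (c @ [hd c]) = 0] (rmod (2 * pi))"
      if "c \<noteq> []" "successively (adjacent G) (c @ [hd c])" for c
      using cycles that by (simp add: undirected_cycle_iff sum_next_node)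
  qed
  then obtain \<phi> :: "nat \<Rightarrow> real" where \<phi>: "\<phi> 0 = 0"
    "\<And>j k. j \<in> verts G \<Longrightarrow> k \<in> verts G \<Longrightarrow> adjacent G j k \<Longrightarrow>
      [beta_ext G b j k = \<phi> j - \<phi> k] (rmod (2 * pi))"
    by blast
  \<comment> \<open>Because \<open>\<phi> 0 = 0\<close>, nothing is lost when the slack coordinate
    is dropped.\<close>
  define \<theta> where "\<theta> = vec n (\<lambda>i. \<phi> (Suc i))"
  have \<theta>: "\<theta> \<in> carrier_vec n" by (simp add: \<theta>_def)
  have angle: "bus_angle \<theta> j = \<phi> j" if "j \<le> n" for j
    using that \<phi>(1) by (cases j) (simp_all add: bus_angle_def \<theta>_def)
  have "[bus_angle \<theta> (tail G e) - bus_angle \<theta> (head G e) = b $ e] (rmod (2 * pi))"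
    if "e < m" for e
  proof -
    have e: "e \<in> arcs G" using that network_graph_arcs(1)[OF G] by simp
    then have "tail G e \<rightarrow>\<^bsub>G\<^esub> head G e" by (auto simp: arcs_ends_conv)
    then show ?thesis
      using \<phi>(2)[of "tail G e" "head G e"] network_graph_arcs(2,3)[OF G that]
      by (simp add: adjacent_def beta_ext_def line_eq[OF G e] angle V rcong_sym)
  qed
  with \<theta> cong_2pi_inc_mat_iff[OF G \<theta> b] show ?solvable by blast
qed

section \<open>The tree submatrix and its inverse\<close>

locale spanning_tree_network =
  fixes n m :: nat and G :: "(nat, nat) pre_digraph" and T :: "nat set"
  assumes network: "network_graph n m G" and tree: "spanning_tree_lines G T"
begin

lemma T_less: "e \<in> T \<Longrightarrow> e < m"
  using tree network by (auto simp: spanning_tree_lines_def network_graph_def)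

lemma finite_T: "finite T"
  using T_less by (meson finite_nat_set_iff_bounded)

lemma card_T: "card T = n"
  using tree network by (simp add: spanning_tree_lines_def network_graph_def)

lemma rows_T: "{i. i < m \<and> i \<in> T} = T"
  using T_less by auto

lemma pick_T: "i < n \<Longrightarrow> pick T i \<in> T"
  using pick_in_set[of i T] card_T by simp

text \<open>The position of \<open>e\<close> is its rank, the number of smaller elements of
  \<open>T\<close>; \<open>e\<close> itself is not counted, so the rank stays below
  \<open>n\<close>.\<close>

lemma pick_T_surj: "e \<in> T \<Longrightarrow> \<exists>i<n. pick T i = e"
proof -
  assume "e \<in> T"
  then have "{a \<in> T. a < e} \<subset> T"
    by (intro psubsetI) blast+
  from psubset_card_mono[OF finite_T this] have "card {a \<in> T. a < e} < n"
    by (simp only: card_T)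
  with pick_card_in_set[OF \<open>e \<in> T\<close>] show ?thesis
    by (rule exI[of _ "card {a \<in> T. a < e}", OF conjI, rotated])
qed

lemma tree_mat_carrier: "tree_mat n m G T \<in> carrier_mat n n"
proof (rule carrier_matI)
  show "dim_row (tree_mat n m G T) = n"
    unfolding tree_mat_def dim_submatrix dim_inc_mat rows_T card_T ..
  show "dim_col (tree_mat n m G T) = n"
    unfolding tree_mat_def dim_submatrix dim_inc_mat by simp
qed

text \<open>Row \<open>i\<close> of the tree matrix is the row of the line \<open>pick T i\<close>
  in the full incidence matrix, since all columns are kept.\<close>

lemma index_tree_mat_mult:
  assumes "\<theta> \<in> carrier_vec n" "i < n"
  shows "(tree_mat n m G T *\<^sub>v \<theta>) $ i =
    bus_angle \<theta> (tail G (pick T i)) - bus_angle \<theta> (head G (pick T i))"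
proof -
  have less: "pick T i < m" using assms pick_T T_less by blast
  have "row (tree_mat n m G T) i = row (inc_mat n m G) (pick T i)"
    using assms less
    by (intro eq_vecI)
      (simp_all add: tree_mat_def dim_submatrix submatrix_index rows_T card_T pick_UNIV)
  then have "(tree_mat n m G T *\<^sub>v \<theta>) $ i = (inc_mat n m G *\<^sub>v \<theta>) $ pick T i"
    using assms less tree_mat_carrier by simp
  then show ?thesis
    using index_inc_mat_mult[OF network assms(1) less] by simp
qed

text \<open>The tree connects all buses, so the agreement at the slack bus spreads to every other
  bus along tree lines alone.\<close>

lemma tree_differences_determine:
  assumes "\<theta> \<in> carrier_vec n" "\<theta>' \<in> carrier_vec n" "i < n"
    and "\<And>e. e \<in> T \<Longrightarrow> [bus_angle \<theta> (tail G e) - bus_angle \<theta> (head G e) =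
      bus_angle \<theta>' (tail G e) - bus_angle \<theta>' (head G e)] (rmod p)"
  shows "[\<theta> $ i = \<theta>' $ i] (rmod p)"
proof -
  have V: "verts G = {0..n}" using network by (simp add: network_graph_def)
  have "[bus_angle \<theta> (Suc i) = bus_angle \<theta>' (Suc i)] (rmod p)"
  proof (rule connected_imp_rcong[of "G\<lparr>arcs := T\<rparr>" _ 0])
    show "Digraph_Component.connected (G\<lparr>arcs := T\<rparr>)"
      using tree by (simp add: spanning_tree_lines_def)
    show "[bus_angle \<theta> (tail (G\<lparr>arcs := T\<rparr>) e) - bus_angle \<theta> (head (G\<lparr>arcs := T\<rparr>) e) =
        bus_angle \<theta>' (tail (G\<lparr>arcs := T\<rparr>) e) - bus_angle \<theta>' (head (G\<lparr>arcs := T\<rparr>) e)] (rmod p)"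
      if "e \<in> arcs (G\<lparr>arcs := T\<rparr>)" for e
      using assms(4)[of e] that by simp
    show "bus_angle \<theta> 0 = bus_angle \<theta>' 0"
      by (simp add: bus_angle_def)
  qed (simp_all add: V \<open>i < n\<close> Suc_leI)
  then show ?thesis by (simp add: bus_angle_def)
qed

text \<open>A kernel vector has the same differences along the tree lines as the zero vector, hence
  equals it; for a square matrix this forces a nonzero determinant.\<close>

lemma mat_inverse_tree_mat:
  obtains C where "mat_inverse (tree_mat n m G T) = Some C"
    and "tree_mat n m G T * C = 1\<^sub>m n" and "C \<in> carrier_mat n n"
proof -
  let ?A = "tree_mat n m G T"
  have zero: "bus_angle (0\<^sub>v n) j = 0" if "j \<le> n" for j
    using that by (cases j) (simp_all add: bus_angle_def)
  have "\<theta> = 0\<^sub>v n" if \<theta>: "\<theta> \<in> carrier_vec n" and A\<theta>: "?A *\<^sub>v \<theta> = 0\<^sub>v n" for \<theta>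
  proof (rule eq_vecI)
    fix i assume "i < dim_vec (0\<^sub>v n :: real vec)"
    then have "i < n" by simp
    have "bus_angle \<theta> (tail G e) - bus_angle \<theta> (head G e) =
        bus_angle (0\<^sub>v n) (tail G e) - bus_angle (0\<^sub>v n) (head G e)" if e: "e \<in> T" for e
    proof -
      obtain l where l: "l < n" "pick T l = e" using pick_T_surj[OF e] by blast
      then have "bus_angle \<theta> (tail G e) - bus_angle \<theta> (head G e) = 0"
        using index_tree_mat_mult[OF \<theta> l(1)] A\<theta> by simp
      then show ?thesis
        using network_graph_arcs(2,3)[OF network T_less[OF e]] by (simp add: zero)
    qed
    \<comment> \<open>Congruence modulo 0 is equality.\<close>
    then have "[\<theta> $ i = 0\<^sub>v n $ i] (rmod 0)"
      by (intro tree_differences_determine \<theta> zero_carrier_vec \<open>i < n\<close>) simp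
    then show "\<theta> $ i = 0\<^sub>v n $ i" by simp
  qed (use \<theta> in simp)
  then have "det ?A \<noteq> 0"
    using det_0_iff_vec_prod_zero[OF tree_mat_carrier] by blast
  then have "?A \<in> Units (ring_mat TYPE(real) n ())"
    by (rule det_non_zero_imp_unit[OF tree_mat_carrier])
  then obtain C where "mat_inverse ?A = Some C"
    using mat_inverse(1)[OF tree_mat_carrier, where b = "()"] by (cases "mat_inverse ?A") auto
  moreover have "?A * C = 1\<^sub>m n" "C \<in> carrier_mat n n"
    using mat_inverse(2)[OF tree_mat_carrier \<open>mat_inverse ?A = Some C\<close>] by blast+
  ultimately show thesis by (rule that)
qed

end

section \<open>The solution in the principal box\<close>

text \<open>Two points of a half-open interval of length \<open>2 * pi\<close> differ by less than
  \<open>2 * pi\<close>, so congruence forces equality.\<close>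

lemma principal_unique:
  assumes "\<theta> \<in> principal_box n" "\<theta>' \<in> principal_box n"
    and "\<And>i. i < n \<Longrightarrow> [\<theta> $ i = \<theta>' $ i] (rmod (2 * pi))"
  shows "\<theta> = \<theta>'"
proof (rule eq_vecI)
  fix i assume "i < dim_vec \<theta>'"
  with assms have "i < n" by (auto simp: principal_box_def)
  with assms(1,2) have "- pi < \<theta> $ i" "\<theta> $ i \<le> pi" "- pi < \<theta>' $ i" "\<theta>' $ i \<le> pi"
    by (auto simp: principal_box_def)
  with assms(3)[OF \<open>i < n\<close>] show "\<theta> $ i = \<theta>' $ i"
    by (intro rcong_imp_eq) auto
qed (use assms in \<open>auto simp: principal_box_def\<close>)

text \<open>The vector \<open>C *\<^sub>v tree_vec b T\<close> solves the tree equations exactly, so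
  every solution is congruent to it. The lines outside the tree are handled through a given
  solution: a vector entrywise congruent to a solution is itself a solution.\<close>

lemma (in spanning_tree_network) principal_solution:
  assumes b: "dim_vec b = m"
    and solvable: "\<exists>\<theta>\<in>carrier_vec n. cong_2pi (inc_mat n m G *\<^sub>v \<theta>) b"
    and C: "tree_mat n m G T * C = 1\<^sub>m n" "C \<in> carrier_mat n n"
  shows "{\<theta> \<in> principal_box n. cong_2pi (inc_mat n m G *\<^sub>v \<theta>) b} = {principal (C *\<^sub>v tree_vec b T)}"
proof -
  define \<psi> where "\<psi> = C *\<^sub>v tree_vec b T"
  have tv: "tree_vec b T \<in> carrier_vec n" by (simp add: tree_vec_def card_T)
  have \<psi>: "\<psi> \<in> carrier_vec n" using C(2) tv by (simp add: \<psi>_def)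
  have "tree_mat n m G T *\<^sub>v \<psi> = tree_vec b T"
    using assoc_mult_mat_vec[OF tree_mat_carrier C(2) tv] C tv by (simp add: \<psi>_def)
  then have \<psi>_diff: "bus_angle \<psi> (tail G e) - bus_angle \<psi> (head G e) = b $ e" if "e \<in> T" for e
    using pick_T_surj[OF that] index_tree_mat_mult[OF \<psi>] by (auto simp: tree_vec_def card_T)
  have congruent: "[\<theta> $ i = principal \<psi> $ i] (rmod (2 * pi))"
    if \<theta>: "\<theta> \<in> carrier_vec n" "cong_2pi (inc_mat n m G *\<^sub>v \<theta>) b" and "i < n" for \<theta> i
  proof -
    have "[\<theta> $ i = \<psi> $ i] (rmod (2 * pi))"
      using \<theta> cong_2pi_inc_mat_iff[OF network \<theta>(1) b] T_less
      by (intro tree_differences_determine \<psi> \<open>i < n\<close>) (auto simp: \<psi>_diff)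
    moreover have "[principal \<psi> $ i = \<psi> $ i] (rmod (2 * pi))"
      using principal_cong[of \<psi>] \<psi> \<open>i < n\<close> by (auto simp: cong_2pi_def)
    ultimately show ?thesis using rcong_sym rcong_trans by blast
  qed
  have box: "principal \<psi> \<in> principal_box n" by (rule principal_in_box[OF \<psi>])
  then have carrier: "principal \<psi> \<in> carrier_vec n" by (simp add: principal_box_def)
  from solvable obtain \<theta> where \<theta>: "\<theta> \<in> carrier_vec n" "cong_2pi (inc_mat n m G *\<^sub>v \<theta>) b" by blast
  \<comment> \<open>At the slack bus both angles are 0; at every other bus \<open>congruent\<close>,
    applied to the given solution \<theta>, yields the claim.\<close>
  have angle: "[bus_angle (principal \<psi>) j = bus_angle \<theta> j] (rmod (2 * pi))" if "j \<le> n" for j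
    using that congruent[OF \<theta>] by (cases j) (auto simp: bus_angle_def intro: rcong_sym)
  have "cong_2pi (inc_mat n m G *\<^sub>v principal \<psi>) b"
    unfolding cong_2pi_inc_mat_iff[OF network carrier b]
  proof (intro allI impI)
    fix e assume "e < m"
    then have "[bus_angle (principal \<psi>) (tail G e) - bus_angle (principal \<psi>) (head G e) =
        bus_angle \<theta> (tail G e) - bus_angle \<theta> (head G e)] (rmod (2 * pi))"
      using network_graph_arcs(2,3)[OF network] by (intro rcong_diff angle)
    also have "[bus_angle \<theta> (tail G e) - bus_angle \<theta> (head G e) = b $ e] (rmod (2 * pi))"
      using \<theta>(2) \<open>e < m\<close> unfolding cong_2pi_inc_mat_iff[OF network \<theta>(1) b] by simp
    finally show "[bus_angle (principal \<psi>) (tail G e) - bus_angle (principal \<psi>) (head G e) =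
        b $ e] (rmod (2 * pi))" .
  qed
  moreover have "\<theta>' = principal \<psi>"
    if "\<theta>' \<in> principal_box n" "cong_2pi (inc_mat n m G *\<^sub>v \<theta>') b" for \<theta>'
    using that congruent box by (intro principal_unique) (auto simp: principal_box_def)
  ultimately show ?thesis
    using box unfolding \<psi>_def by blast
qed

theorem theorem8:
  fixes n m :: nat
    and G :: "(nat, nat) pre_digraph"
    and z :: "nat \<Rightarrow> complex"
    and v_lo v_up :: "nat \<Rightarrow> real"
    and s_lo s_up :: "nat \<Rightarrow> cbound"
    and T :: "nat set"
    and x :: bfm_point
  assumes "network_graph n m G"
    and "\<forall>e\<in>arcs G. z e \<noteq> 0"
    and "\<forall>j\<in>verts G. 0 < v_lo j \<and> v_lo j \<le> v_up j"
    and "v_lo 0 = 1" and "v_up 0 = 1"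
    and "s_lo 0 = (- \<infinity>, - \<infinity>)" and "s_up 0 = (\<infinity>, \<infinity>)"
    and "spanning_tree_lines G T"
    and "x \<in> X_nc n m G z v_lo v_up s_lo s_up"
  shows "((\<exists>\<theta>\<in>carrier_vec n. cong_2pi (inc_mat n m G *\<^sub>v \<theta>) (beta m G z x)) \<longleftrightarrow>
          (\<forall>c. undirected_cycle G c \<longrightarrow>
             [(\<Sum>i<length c. beta_ext G (beta m G z x) (c ! i) (next_node c i)) = 0] (rmod (2 * pi)))) \<and>
         ((\<exists>\<theta>\<in>carrier_vec n. cong_2pi (inc_mat n m G *\<^sub>v \<theta>) (beta m G z x)) \<longrightarrow>
          (\<exists>B_T_inv. mat_inverse (tree_mat n m G T) = Some B_T_inv \<and>
             {\<theta> \<in> principal_box n. cong_2pi (inc_mat n m G *\<^sub>v \<theta>) (beta m G z x)} =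
             {principal (B_T_inv *\<^sub>v tree_vec (beta m G z x) T)}))"
proof -
  interpret spanning_tree_network n m G T
    using assms(1,8) by unfold_locales
  have b: "dim_vec (beta m G z x) = m"
    by (simp add: beta_def split: prod.split)
  obtain C where C: "mat_inverse (tree_mat n m G T) = Some C"
    "tree_mat n m G T * C = 1\<^sub>m n" "C \<in> carrier_mat n n"
    by (rule mat_inverse_tree_mat)
  show ?thesis
    using solvable_iff_cycle_condition[OF network b] C(1) principal_solution[OF b _ C(2,3)] by simp
qed

end
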